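(* Let $G$ be a finite group. Then the coset nerve $\mathcal{NC}_{\mathrm{nor}}(G)$ is not contractible.
   Context: For a set $\mathcal{K}$ of subgroups of a group $G$, let $\mathrm{Cosets}(\mathcal{K})=\{gH : g\in G, H\in\mathcal{K}\}$. The coset nerve $\mathcal{NC}(\mathcal{K})$ is the (geometric realization of the) abstract simplicial complex with vertex set $\mathrm{Cosets}(\mathcal{K})$ in which a finite nonempty set of cosets is a simplex if and only if the intersection of these cosets is nonempty. $\mathcal{H}_{\mathrm{nor}}(G)$ denotes the set of all proper normal subgroups of $G$ (those $N\trianglelefteq G$ with $N\neq G$), and $\mathcal{NC}_{\mathrm{nor}}(G):=\mathcal{NC}(\mathcal{H}_{\mathrm{nor}}(G))$. The empty space is not contractible. *)

theory Defs
  imports "HOL-Analysis.Analysis" "HOL-Algebra.Coset"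
begin

text \<open>
  An abstract simplicial complex is given by the set \<open>K\<close> of its (finite, nonempty) simplices.
  Points of its geometric realization are written in barycentric coordinates, as functions on
  the vertices.
\<close>

definition closed_simplex :: "'v set \<Rightarrow> ('v \<Rightarrow> real) set"
  where "closed_simplex \<sigma> = {x. (\<forall>v. 0 \<le> x v) \<and> (\<forall>v. v \<notin> \<sigma> \<longrightarrow> x v = 0) \<and> (\<Sum>v\<in>\<sigma>. x v) = 1}"

text \<open>
  The weak topology: a set is open iff it meets every closed simplex in a relatively open set.
  On a closed simplex of a finite \<open>\<sigma>\<close>, the pointwise topology of the function space
  is the Euclidean one.
\<close>

definition geometric_realization :: "'v set set \<Rightarrow> ('v \<Rightarrow> real) topology"
  where "geometric_realization K =
    topology (\<lambda>U. U \<subseteq> (\<Union>\<sigma>\<in>K. closed_simplex \<sigma>) \<and>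
      (\<forall>\<sigma>\<in>K. openin (top_of_set (closed_simplex \<sigma>)) (U \<inter> closed_simplex \<sigma>)))"

lemma openin_geometric_realization:
  "openin (geometric_realization K) U \<longleftrightarrow>
    U \<subseteq> (\<Union>\<sigma>\<in>K. closed_simplex \<sigma>) \<and>
    (\<forall>\<sigma>\<in>K. openin (top_of_set (closed_simplex \<sigma>)) (U \<inter> closed_simplex \<sigma>))"
proof -
  have "istopology (\<lambda>U. U \<subseteq> (\<Union>\<sigma>\<in>K. closed_simplex \<sigma>) \<and>
      (\<forall>\<sigma>\<in>K. openin (top_of_set (closed_simplex \<sigma>)) (U \<inter> closed_simplex \<sigma>)))"
    (is "istopology ?P")
    unfolding istopology_def
  proof (intro conjI allI impI)
    fix S T assume S: "?P S" and T: "?P T"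
    show "S \<inter> T \<subseteq> (\<Union>\<sigma>\<in>K. closed_simplex \<sigma>)"
      using S by blast
    show "\<forall>\<sigma>\<in>K. openin (top_of_set (closed_simplex \<sigma>)) (S \<inter> T \<inter> closed_simplex \<sigma>)"
    proof
      fix \<sigma> assume "\<sigma> \<in> K"
      then have "openin (top_of_set (closed_simplex \<sigma>))
          ((S \<inter> closed_simplex \<sigma>) \<inter> (T \<inter> closed_simplex \<sigma>))"
        using S T by (blast intro: openin_Int[where S = "S \<inter> closed_simplex \<sigma>"])
      moreover have "(S \<inter> closed_simplex \<sigma>) \<inter> (T \<inter> closed_simplex \<sigma>) = S \<inter> T \<inter> closed_simplex \<sigma>"
        by blast
      ultimately show "openin (top_of_set (closed_simplex \<sigma>)) (S \<inter> T \<inter> closed_simplex \<sigma>)"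
        by simp
    qed
  next
    fix \<U> assume U: "\<forall>S\<in>\<U>. ?P S"
    show "\<Union>\<U> \<subseteq> (\<Union>\<sigma>\<in>K. closed_simplex \<sigma>)"
      using U by blast
    show "\<forall>\<sigma>\<in>K. openin (top_of_set (closed_simplex \<sigma>)) (\<Union>\<U> \<inter> closed_simplex \<sigma>)"
    proof
      fix \<sigma> assume "\<sigma> \<in> K"
      then have "openin (top_of_set (closed_simplex \<sigma>)) (\<Union>S\<in>\<U>. S \<inter> closed_simplex \<sigma>)"
        using U by (intro openin_Union) blast
      moreover have "(\<Union>S\<in>\<U>. S \<inter> closed_simplex \<sigma>) = \<Union>\<U> \<inter> closed_simplex \<sigma>"
        by blast
      ultimately show "openin (top_of_set (closed_simplex \<sigma>)) (\<Union>\<U> \<inter> closed_simplex \<sigma>)"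
        by simp
    qed
  qed
  then show ?thesis
    by (simp add: geometric_realization_def)
qed

lemma topspace_geometric_realization:
  "topspace (geometric_realization K) = (\<Union>\<sigma>\<in>K. closed_simplex \<sigma>)"
proof (rule antisym)
  show "topspace (geometric_realization K) \<subseteq> (\<Union>\<sigma>\<in>K. closed_simplex \<sigma>)"
    using openin_geometric_realization[of K "topspace (geometric_realization K)"] by simp
  have "(\<Union>\<sigma>\<in>K. closed_simplex \<sigma>) \<inter> closed_simplex \<tau> = closed_simplex \<tau>" if "\<tau> \<in> K" for \<tau>
    using that by blast
  then have "openin (geometric_realization K) (\<Union>\<sigma>\<in>K. closed_simplex \<sigma>)"
    by (simp add: openin_geometric_realization)
  then show "(\<Union>\<sigma>\<in>K. closed_simplex \<sigma>) \<subseteq> topspace (geometric_realization K)"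
    by (rule openin_subset)
qed

definition all_cosets :: "('a, 'b) monoid_scheme \<Rightarrow> 'a set set \<Rightarrow> 'a set set"
  where "all_cosets G \<K> = {g <#\<^bsub>G\<^esub> H | g H. g \<in> carrier G \<and> H \<in> \<K>}"

definition coset_nerve_complex :: "('a, 'b) monoid_scheme \<Rightarrow> 'a set set \<Rightarrow> 'a set set set"
  where "coset_nerve_complex G \<K> =
    {\<sigma>. finite \<sigma> \<and> \<sigma> \<noteq> {} \<and> \<sigma> \<subseteq> all_cosets G \<K> \<and> \<Inter>\<sigma> \<noteq> {}}"

definition coset_nerve :: "('a, 'b) monoid_scheme \<Rightarrow> 'a set set \<Rightarrow> ('a set \<Rightarrow> real) topology"
  where "coset_nerve G \<K> = geometric_realization (coset_nerve_complex G \<K>)"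

definition proper_normal_subgroups :: "('a, 'b) monoid_scheme \<Rightarrow> 'a set set"
  where "proper_normal_subgroups G = {N. N \<lhd> G \<and> N \<noteq> carrier G}"

definition normal_coset_nerve :: "('a, 'b) monoid_scheme \<Rightarrow> ('a set \<Rightarrow> real) topology"
  where "normal_coset_nerve G = coset_nerve G (proper_normal_subgroups G)"

text \<open>
  The library predicate \<^const>\<open>contractible_space\<close> holds of the empty space; here the empty
  space is not contractible.  The difference matters for the trivial group, which has no proper
  subgroup and hence an empty nerve.
\<close>

definition nonempty_contractible_space :: "'a topology \<Rightarrow> bool"
  where "nonempty_contractible_space X \<longleftrightarrow> topspace X \<noteq> {} \<and> contractible_space X"

end

theory Submission
  imports Defs "HOL-Homology.Brouwer_Degree" "HOL-Algebra.SndIsomorphismGrp"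
begin

text \<open>
  The nerve of a nontrivial finite group \<open>G\<close> is compared with a sphere in both directions.

  Choose an irredundant family \<open>M 0, \<dots>, M p\<close> of maximal normal subgroups with the same intersection as
  all maximal normal subgroups (\<open>irredundant_subfamily\<close>), and for each \<open>i\<close> an element \<open>x i\<close> that lies in
  every member of the family except \<open>M i\<close>.  By the Chinese remainder theorem
  (\<open>ex_in_cosets_of_independent_family\<close>), if for each \<open>i\<close> one of the cosets \<open>M i\<close> and \<open>x i M i\<close> is
  chosen, the chosen cosets have a common element.  So these cosets span the boundary of a
  cross-polytope, a sphere of dimension \<open>p\<close>, in the nerve.

  In the other direction, colour an element of \<open>G\<close> by the first \<open>i\<close> with \<open>M i\<close> not containing it, and by
  \<open>p + 1\<close> if there is none.  A coset of a proper normal subgroup never has elements of all colours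
  (\<open>proper_coset_misses_colour\<close>), because the partial intersections of the \<open>M i\<close> form a chain with
  chief factors.  Label each coset by the greatest colour that it misses.  If \<open>y\<close> is a common element of
  the cosets in a simplex, then the colour of \<open>y\<close> is not among the labels of the simplex.  So the
  labelling maps the nerve to the boundary of a simplex of dimension \<open>p + 1\<close>, again a sphere
  of dimension \<open>p\<close>.

  The coset \<open>M i\<close> has label \<open>i\<close>, and \<open>x i M i\<close> has label \<open>p + 1\<close>.  With these labels, the composite map
  between the two spheres is a homotopy equivalence
  (\<open>not_contractible_geometric_realization_if_labelled\<close>), so it cannot factor through a contractible
  space.
\<close>

section \<open>Spheres and realizations of finite complexes\<close>

text \<open>
  Euclidean space of dimension \<open>p + 1\<close> without the origin, carried by functions on the natural numbers
  so that the dimension can depend on the group.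
\<close>

definition punctured_space :: "nat \<Rightarrow> (nat \<Rightarrow> real) set"
  where "punctured_space p = {x. (\<forall>i>p. x i = 0) \<and> (\<exists>i\<le>p. x i \<noteq> 0)}"

text \<open>
  The unit sphere is a retract of the punctured space, and no sphere is contractible.
\<close>

lemma not_contractible_punctured_space: "\<not> contractible (punctured_space p)"
proof
  assume contr: "contractible (punctured_space p)"
  define S where "S = {x :: nat \<Rightarrow> real. (\<forall>i>p. x i = 0) \<and> (\<Sum>i\<le>p. (x i)\<^sup>2) = 1}"
  have nsphere_eq: "nsphere p = top_of_set S"
    by (simp add: nsphere S_def euclidean_product_topology conj_commute)
  define r where "r x = sqrt (\<Sum>i\<le>p. (x i)\<^sup>2)" for x :: "nat \<Rightarrow> real"
  define N where "N x = (\<lambda>i. x i / r x)" for x :: "nat \<Rightarrow> real"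
  have r_pos: "r x > 0" if x: "x \<in> punctured_space p" for x
  proof -
    obtain i where i: "i \<le> p" "x i \<noteq> 0"
      using x by (auto simp: punctured_space_def)
    have "0 < (\<Sum>i\<le>p. (x i)\<^sup>2)"
      using i by (intro sum_pos2[where i = i]) auto
    then show ?thesis by (simp add: r_def)
  qed
  have cont_coord: "continuous_on A (\<lambda>x :: nat \<Rightarrow> real. x i)" for A i
    by (rule continuous_on_product_then_coordinatewise) (rule continuous_on_id)
  have N_cont: "continuous_on (punctured_space p) N"
    unfolding N_def r_def
    using r_pos
    by (intro continuous_on_coordinatewise_then_product continuous_intros cont_coord)
       (force simp: r_def)
  have N_S: "N x \<in> S" if x: "x \<in> punctured_space p" for x
  proof -
    have "(\<Sum>i\<le>p. (N x i)\<^sup>2) = (\<Sum>i\<le>p. (x i)\<^sup>2) / (r x)\<^sup>2"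
      by (simp add: N_def power_divide sum_divide_distrib)
    also have "(r x)\<^sup>2 = (\<Sum>i\<le>p. (x i)\<^sup>2)"
      by (simp add: r_def sum_nonneg)
    finally show ?thesis
      using x r_pos[OF x] unfolding S_def punctured_space_def
      by (auto simp: N_def r_def)
  qed
  have S_sub: "S \<subseteq> punctured_space p"
    unfolding S_def punctured_space_def by (force simp: Suc_le_eq intro: ccontr)
  have "contractible_space (nsphere p)"
  proof (rule homotopy_dominated_contractibility)
    show "contractible_space (top_of_set (punctured_space p))"
      using contr by simp
    show "continuous_map (top_of_set (punctured_space p)) (nsphere p) N"
      using N_cont N_S by (auto simp: nsphere_eq)
    show "continuous_map (nsphere p) (top_of_set (punctured_space p)) id"
      using S_sub by (auto simp: nsphere_eq)
    show "homotopic_with (\<lambda>_. True) (nsphere p) (nsphere p) (N \<circ> id) id"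
    proof (rule homotopic_with_equal)
      show "continuous_map (nsphere p) (nsphere p) (N \<circ> id)"
        using N_cont N_S S_sub by (auto simp: nsphere_eq intro: continuous_on_subset)
      show "(N \<circ> id) x = id x" if "x \<in> topspace (nsphere p)" for x
        using that by (auto simp: nsphere_eq S_def N_def r_def)
    qed auto
  qed
  then show False
    using non_contractible_space_nsphere by blast
qed

lemma closed_closed_simplex: "closed (closed_simplex \<sigma>)"
proof -
  have cont: "continuous_on UNIV (\<lambda>x :: 'a \<Rightarrow> real. x v)" for v
    by (rule continuous_on_product_then_coordinatewise) (rule continuous_on_id)
  have "closed_simplex \<sigma> =
      (\<Inter>v. {x. 0 \<le> x v}) \<inter> (\<Inter>v \<in> - \<sigma>. {x. x v = 0}) \<inter> {x. (\<Sum>v\<in>\<sigma>. x v) = 1}"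
    by (auto simp: closed_simplex_def)
  then show ?thesis
    by (auto intro!: closed_Int closed_INT closed_Collect_le closed_Collect_eq
        continuous_on_sum cont continuous_on_const)
qed

text \<open>
  Closed simplices are closed in the whole function space, and a finite union of relatively
  closed pieces is closed.  So for finite complexes, continuity of maps into and out of the
  realization can be checked coordinate by coordinate.
\<close>

lemma geometric_realization_finite:
  assumes "finite K"
  shows "geometric_realization K = top_of_set (\<Union>\<sigma>\<in>K. closed_simplex \<sigma>)" (is "_ = top_of_set ?R")
proof (rule topology_eq[THEN iffD2], intro allI iffI)
  fix U
  assume U: "openin (geometric_realization K) U"
  have "closedin (top_of_set (closed_simplex \<sigma>)) (closed_simplex \<sigma> - U)" if "\<sigma> \<in> K" for \<sigma>
  proof -
    have "closed_simplex \<sigma> - U = closed_simplex \<sigma> - (U \<inter> closed_simplex \<sigma>)"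
      by blast
    then show ?thesis
      using U that by (auto simp: openin_geometric_realization intro: closedin_diff)
  qed
  then have "closed (closed_simplex \<sigma> - U)" if "\<sigma> \<in> K" for \<sigma>
    using that closed_closed_simplex closedin_closed_trans by blast
  then have "closed (\<Union>\<sigma>\<in>K. closed_simplex \<sigma> - U)"
    using assms by (intro closed_UN) auto
  then have "openin (top_of_set ?R) (?R - (\<Union>\<sigma>\<in>K. closed_simplex \<sigma> - U))"
    by (metis Diff_eq open_Compl openin_open_Int)
  moreover have "?R - (\<Union>\<sigma>\<in>K. closed_simplex \<sigma> - U) = U"
    using U by (auto simp: openin_geometric_realization)
  ultimately show "openin (top_of_set ?R) U"
    by simp
next
  fix U
  assume "openin (top_of_set ?R) U"
  then obtain T where T: "open T" "U = ?R \<inter> T"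
    by (auto simp: openin_open)
  have "openin (top_of_set (closed_simplex \<sigma>)) (U \<inter> closed_simplex \<sigma>)" if "\<sigma> \<in> K" for \<sigma>
  proof -
    have "U \<inter> closed_simplex \<sigma> = closed_simplex \<sigma> \<inter> T"
      using T that by blast
    then show ?thesis
      using T by (auto simp: openin_open)
  qed
  then show "openin (geometric_realization K) U"
    using T by (auto simp: openin_geometric_realization)
qed

text \<open>
  A criterion in the spirit of Sperner's lemma.  The vertices \<open>a i\<close>, \<open>b i\<close> span the boundary of a
  \<open>(p + 1)\<close>-dimensional cross-polytope inside the complex (with \<open>a i\<close> and \<open>b i\<close> antipodal), and the
  labelling is a simplicial map from the complex to the boundary of a simplex with vertices
  \<open>0, \<dots>, p + 1\<close>, since no simplex carries all the labels.  Place this simplex in Euclidean space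
  with vertex \<open>i \<le> p\<close> at the \<open>i\<close>-th unit vector and vertex \<open>p + 1\<close> at \<open>(-1, \<dots>, -1)\<close>, so that the
  origin is an interior point.  The composite of the two maps sends \<open>x\<close> to a positive multiple of
  the vector with coordinates \<open>max (x i) 0 - s\<close>, where \<open>s\<close> is the sum of the negative parts of \<open>x\<close>.
  This is never a nonpositive multiple
  of \<open>x\<close>: if \<open>x\<close> has a negative coordinate, both vectors are negative there, and otherwise they are
  positively proportional.  A straight-line homotopy avoiding the origin therefore joins the composite to
  the identity of the punctured space, which would be contractible if the realization were.
\<close>

lemma not_contractible_geometric_realization_if_labelled:
  fixes K :: "'v set set" and label :: "'v \<Rightarrow> nat" and a b :: "nat \<Rightarrow> 'v"
  assumes fin: "finite K" "\<And>\<sigma>. \<sigma> \<in> K \<Longrightarrow> finite \<sigma>"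
    and label_le: "\<And>\<sigma> v. \<sigma> \<in> K \<Longrightarrow> v \<in> \<sigma> \<Longrightarrow> label v \<le> Suc p"
    and missed: "\<And>\<sigma>. \<sigma> \<in> K \<Longrightarrow> \<exists>k\<le>Suc p. k \<notin> label ` \<sigma>"
    and label_a: "\<And>i. i \<le> p \<Longrightarrow> label (a i) = i"
    and label_b: "\<And>i. i \<le> p \<Longrightarrow> label (b i) = Suc p"
    and cross: "\<And>A B. A \<subseteq> {..p} \<Longrightarrow> B \<subseteq> {..p} \<Longrightarrow> A \<inter> B = {} \<Longrightarrow> A \<union> B \<noteq> {} \<Longrightarrow>
      a ` A \<union> b ` B \<in> K"
  shows "\<not> contractible_space (geometric_realization K)"
proof
  assume contr: "contractible_space (geometric_realization K)"
  define V where "V = \<Union>K"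
  define R where "R = (\<Union>\<sigma>\<in>K. closed_simplex \<sigma>)"
  let ?E = "punctured_space p"
  have finV: "finite V"
    using fin by (simp add: V_def)
  have real_eq: "geometric_realization K = top_of_set R"
    using geometric_realization_finite[OF fin(1)] by (simp add: R_def)

  \<comment> \<open>\<open>e v\<close> is the point of Euclidean space at which the label of \<open>v\<close> is placed, \<open>F\<close> the resulting
    map on the realization, and \<open>g\<close> the parametrization of the cross-polytope.\<close>
  define e where "e v i = (if label v = i then 1 else 0) - (if label v = Suc p then 1 else (0::real))"
    for v i
  define F where "F t = (\<lambda>i. if i \<le> p then \<Sum>v\<in>V. t v * e v i else 0)"
    for t :: "'v \<Rightarrow> real"
  define norm1 where "norm1 x = (\<Sum>i\<le>p. \<bar>x i\<bar>)" for x :: "nat \<Rightarrow> real"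
  define g where "g x = (\<lambda>v. (\<Sum>i\<le>p. (if v = a i then max (x i) 0 else 0) +
      (if v = b i then max (- x i) 0 else 0)) / norm1 x)" for x :: "nat \<Rightarrow> real"

  have cont_coord: "continuous_on A (\<lambda>x :: 'c \<Rightarrow> real. x i)" for A i
    by (rule continuous_on_product_then_coordinatewise) (rule continuous_on_id)

  have F_cont: "continuous_on R F"
    unfolding F_def
  proof (intro continuous_on_coordinatewise_then_product)
    show "continuous_on R (\<lambda>t. if i \<le> p then \<Sum>v\<in>V. t v * e v i else 0)" for i
      by (cases "i \<le> p") (auto intro!: continuous_intros cont_coord)
  qed
  have F_in: "F t \<in> ?E" if "t \<in> R" for t
  proof -
    obtain \<sigma> where \<sigma>: "\<sigma> \<in> K" "t \<in> closed_simplex \<sigma>"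
      using \<open>t \<in> R\<close> by (auto simp: R_def)
    have t: "\<And>v. 0 \<le> t v" "\<And>v. v \<notin> \<sigma> \<Longrightarrow> t v = 0" "(\<Sum>v\<in>\<sigma>. t v) = 1"
      using \<sigma>(2) by (auto simp: closed_simplex_def)
    \<comment> \<open>If \<open>F t\<close> vanished, all labels would carry the same mass, which is zero for the missed label
      although the masses add up to one.\<close>
    define w where "w k = (\<Sum>v\<in>{v \<in> V. label v = k}. t v)" for k
    have F_w: "F t i = w i - w (Suc p)" if "i \<le> p" for i
      using that
      by (simp add: F_def e_def w_def right_diff_distrib sum_subtractf sum.inter_filter[OF finV]
          if_distrib[of "\<lambda>x. _ * x"] cong: if_cong)
    have "\<sigma> \<subseteq> V"
      using \<sigma>(1) by (auto simp: V_def)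
    have "(\<Sum>k\<le>Suc p. w k) = (\<Sum>v\<in>V. t v)"
      unfolding w_def
      using label_le by (intro sum.group finV) (auto simp: V_def)
    also have "\<dots> = (\<Sum>v\<in>\<sigma>. t v)"
      using t(2) \<open>\<sigma> \<subseteq> V\<close> by (intro sum.mono_neutral_right finV) auto
    finally have sum_w: "(\<Sum>k\<le>Suc p. w k) = 1"
      using t(3) by simp
    obtain k where k: "k \<le> Suc p" "k \<notin> label ` \<sigma>"
      using missed[OF \<sigma>(1)] by blast
    then have w_k: "w k = 0"
      unfolding w_def using t(2) by (intro sum.neutral) auto
    have "\<exists>i\<le>p. F t i \<noteq> 0"
    proof (rule ccontr)
      assume "\<not> (\<exists>i\<le>p. F t i \<noteq> 0)"
      then have eq: "w i = w (Suc p)" if "i \<le> Suc p" for i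
        using F_w that by (cases "i = Suc p") (auto simp: le_Suc_eq)
      then have "w i = 0" if "i \<le> Suc p" for i
        using w_k k(1) that by metis
      then show False
        using sum_w by simp
    qed
    then show ?thesis
      by (auto simp: punctured_space_def F_def)
  qed

  have norm1_pos: "norm1 x > 0" if "x \<in> ?E" for x
  proof -
    obtain i where "i \<le> p" "x i \<noteq> 0"
      using \<open>x \<in> ?E\<close> by (auto simp: punctured_space_def)
    then show ?thesis
      unfolding norm1_def by (intro sum_pos2[where i = i]) auto
  qed
  have g_cont: "continuous_on ?E g"
    unfolding g_def
  proof (intro continuous_on_coordinatewise_then_product)
    have *: "continuous_on ?E (\<lambda>x. if P then f x else 0)" if "continuous_on ?E f"
      for P and f :: "(nat \<Rightarrow> real) \<Rightarrow> real"
      using that by (cases P) auto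
    have "continuous_on ?E norm1"
      unfolding norm1_def by (intro continuous_intros cont_coord)
    then show "continuous_on ?E (\<lambda>x. (\<Sum>i\<le>p. (if v = a i then max (x i) 0 else 0) +
        (if v = b i then max (- x i) 0 else 0)) / norm1 x)" for v
      using norm1_pos by (intro continuous_intros * cont_coord) (metis less_irrefl)+
  qed
  have sum_g: "(\<Sum>v\<in>S. g x v * h v) = (\<Sum>i\<le>p. max (x i) 0 * h (a i) + max (- x i) 0 * h (b i)) / norm1 x"
    if S: "finite S" "\<And>i. i \<le> p \<Longrightarrow> x i > 0 \<Longrightarrow> a i \<in> S" "\<And>i. i \<le> p \<Longrightarrow> x i < 0 \<Longrightarrow> b i \<in> S"
    for S x h
  proof -
    have "(\<Sum>v\<in>S. g x v * h v) =
        (\<Sum>v\<in>S. \<Sum>i\<le>p. (if v = a i then max (x i) 0 * h v else 0) +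
          (if v = b i then max (- x i) 0 * h v else 0)) / norm1 x"
      unfolding g_def sum_divide_distrib sum_distrib_right times_divide_eq_left
      by (intro sum.cong refl) (auto simp: distrib_right)
    also have "\<dots> = (\<Sum>i\<le>p. \<Sum>v\<in>S. (if v = a i then max (x i) 0 * h v else 0) +
          (if v = b i then max (- x i) 0 * h v else 0)) / norm1 x"
      by (subst sum.swap) simp
    also have "(\<Sum>i\<le>p. \<Sum>v\<in>S. (if v = a i then max (x i) 0 * h v else 0) +
          (if v = b i then max (- x i) 0 * h v else 0)) =
        (\<Sum>i\<le>p. max (x i) 0 * h (a i) + max (- x i) 0 * h (b i))"
    proof (intro sum.cong refl)
      fix i assume "i \<in> {..p}"
      then have "i \<le> p" by simp
      have "(\<Sum>v\<in>S. if v = a i then max (x i) 0 * h v else 0) = max (x i) 0 * h (a i)"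
        using S(1) S(2)[OF \<open>i \<le> p\<close>] by (cases "x i > 0") (auto simp: sum.delta max_def)
      moreover have "(\<Sum>v\<in>S. if v = b i then max (- x i) 0 * h v else 0) = max (- x i) 0 * h (b i)"
        using S(1) S(3)[OF \<open>i \<le> p\<close>] by (cases "x i < 0") (auto simp: sum.delta max_def)
      ultimately show "(\<Sum>v\<in>S. (if v = a i then max (x i) 0 * h v else 0) +
          (if v = b i then max (- x i) 0 * h v else 0)) =
          max (x i) 0 * h (a i) + max (- x i) 0 * h (b i)"
        by (simp add: sum.distrib)
    qed
    finally show ?thesis .
  qed
  have g_in: "g x \<in> R" if "x \<in> ?E" for x
  proof -
    define A where "A = {i. i \<le> p \<and> x i > 0}"
    define B where "B = {i. i \<le> p \<and> x i < 0}"
    have "A \<union> B \<noteq> {}"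
      using \<open>x \<in> ?E\<close> by (force simp: A_def B_def punctured_space_def)
    then have \<sigma>: "a ` A \<union> b ` B \<in> K"
      by (intro cross) (auto simp: A_def B_def)
    have "0 \<le> g x v" for v
      unfolding g_def using norm1_pos[OF \<open>x \<in> ?E\<close>]
      by (intro divide_nonneg_pos sum_nonneg) auto
    moreover have "g x v = 0" if "v \<notin> a ` A \<union> b ` B" for v
    proof -
      have "(if v = a i then max (x i) 0 else 0) + (if v = b i then max (- x i) 0 else 0) = 0"
        if "i \<le> p" for i
      proof -
        have "v \<noteq> a i \<or> x i \<le> 0" "v \<noteq> b i \<or> 0 \<le> x i"
          using \<open>v \<notin> a ` A \<union> b ` B\<close> that by (force simp: A_def B_def)+
        then show ?thesis
          by auto
      qed
      then show ?thesis
        by (simp add: g_def)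
    qed
    moreover have "(\<Sum>v\<in>a ` A \<union> b ` B. g x v) = 1"
    proof -
      have "(\<Sum>v\<in>a ` A \<union> b ` B. g x v) = (\<Sum>i\<le>p. max (x i) 0 + max (- x i) 0) / norm1 x"
        using sum_g[of "a ` A \<union> b ` B" x "\<lambda>_. 1"] fin(2)[OF \<sigma>]
        by (simp add: A_def B_def)
      also have "(\<Sum>i\<le>p. max (x i) 0 + max (- x i) 0) = norm1 x"
        unfolding norm1_def by (intro sum.cong) auto
      finally show ?thesis
        using norm1_pos[OF \<open>x \<in> ?E\<close>] by simp
    qed
    ultimately show ?thesis
      unfolding R_def closed_simplex_def by (intro UN_I[OF \<sigma>]) blast
  qed

  define neg where "neg x = (\<Sum>j\<le>p. max (- x j) 0)" for x :: "nat \<Rightarrow> real"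
  have F_g: "F (g x) i = (max (x i) 0 - neg x) / norm1 x" if "i \<le> p" for x i
  proof -
    have "a j \<in> V" "b j \<in> V" if "j \<le> p" for j
      using cross[of "{j}" "{}"] cross[of "{}" "{j}"] that by (auto simp: V_def)
    then have "F (g x) i = (\<Sum>j\<le>p. max (x j) 0 * e (a j) i + max (- x j) 0 * e (b j) i) / norm1 x"
      using sum_g[of V x "\<lambda>v. e v i"] finV \<open>i \<le> p\<close> by (simp add: F_def)
    also have "(\<Sum>j\<le>p. max (x j) 0 * e (a j) i + max (- x j) 0 * e (b j) i) =
        (\<Sum>j\<le>p. (if j = i then max (x j) 0 else 0) - max (- x j) 0)"
      using \<open>i \<le> p\<close> by (intro sum.cong) (auto simp: e_def label_a label_b)
    also have "\<dots> = max (x i) 0 - neg x"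
      using \<open>i \<le> p\<close> by (simp add: sum_subtractf neg_def)
    finally show ?thesis .
  qed

  define H where "H s x = (\<lambda>i. (1 - s) * F (g x) i + s * x i)" for s and x :: "nat \<Rightarrow> real"
  have H_in: "H s x \<in> ?E" if s: "0 \<le> s" "s \<le> 1" and x: "x \<in> ?E" for s x
  proof -
    have "\<exists>i\<le>p. H s x i \<noteq> 0"
    proof (cases "\<exists>i\<le>p. x i < 0")
      case True
      then obtain i where i: "i \<le> p" "x i < 0" by blast
      have "0 < neg x"
        unfolding neg_def using i by (intro sum_pos2[where i = i]) auto
      then have "F (g x) i < 0"
        using i norm1_pos[OF x] by (simp add: F_g divide_neg_pos)
      then have "H s x i < 0"
        using i s unfolding H_def by (intro convex_bound_lt) auto
      then show ?thesis
        using i by auto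
    next
      case False
      then have "neg x = 0"
        unfolding neg_def by (intro sum.neutral) (auto simp: not_less)
      obtain i where i: "i \<le> p" "x i > 0"
        using x False by (force simp: punctured_space_def)
      then have "F (g x) i > 0"
        using norm1_pos[OF x] \<open>neg x = 0\<close> by (simp add: F_g)
      then have "H s x i > 0"
        using i s convex_bound_lt[of "- F (g x) i" 0 "- x i" "1 - s" s] by (simp add: H_def)
      then show ?thesis
        using i by auto
    qed
    then show ?thesis
      using x by (auto simp: punctured_space_def H_def F_def)
  qed
  have Fg_cont: "continuous_on ?E (\<lambda>x. F (g x))"
    using continuous_on_compose2[OF F_cont g_cont] g_in by blast
  have "contractible_space (top_of_set ?E)"
  proof (rule homotopy_dominated_contractibility)
    show "contractible_space (top_of_set R)"
      using contr real_eq by simp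
    show "continuous_map (top_of_set R) (top_of_set ?E) F"
      using F_cont F_in by auto
    show "continuous_map (top_of_set ?E) (top_of_set R) g"
      using g_cont g_in by auto
    have "continuous_on ({0..1} \<times> ?E) (\<lambda>y. H (fst y) (snd y))"
      unfolding H_def
    proof (rule continuous_on_coordinatewise_then_product)
      fix i
      have "continuous_on ({0..1} \<times> ?E) (\<lambda>y. F (g (snd y)))"
        by (rule continuous_on_compose2[OF Fg_cont]) (auto intro: continuous_intros)
      then have "continuous_on ({0..1} \<times> ?E) (\<lambda>y. F (g (snd y)) i)"
        by (rule continuous_on_product_then_coordinatewise)
      moreover have "continuous_on ({0..1} \<times> ?E) (\<lambda>y. snd y i)"
        by (rule continuous_on_product_then_coordinatewise) (rule continuous_intros continuous_on_id)+
      ultimately show "continuous_on ({0..1} \<times> ?E)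
          (\<lambda>y. (1 - fst y) * F (g (snd y)) i + fst y * snd y i)"
        by (intro continuous_on_add continuous_on_mult continuous_on_diff continuous_on_const
            continuous_on_fst continuous_on_id)
    qed
    then show "homotopic_with (\<lambda>_. True) (top_of_set ?E) (top_of_set ?E) (F \<circ> g) id"
      unfolding homotopic_with_def using H_in
      by (intro exI[where x = "\<lambda>y. H (fst y) (snd y)"]) (auto simp: H_def)
  qed
  then show False
    using not_contractible_punctured_space by simp
qed

section \<open>Maximal normal subgroups\<close>

definition maximal_normal_subgroups :: "('a, 'b) monoid_scheme \<Rightarrow> 'a set set"
  where "maximal_normal_subgroups G =
    {M \<in> proper_normal_subgroups G. \<forall>N\<in>proper_normal_subgroups G. M \<subseteq> N \<longrightarrow> N = M}"

lemma maximal_normal_subgroupD: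
  assumes "M \<in> maximal_normal_subgroups G"
  shows "M \<lhd> G" "subgroup M G" "M \<subset> carrier G"
  using assms normal_imp_subgroup subgroup.subset
  by (fastforce simp: maximal_normal_subgroups_def proper_normal_subgroups_def)+

lemma finite_proper_normal_subgroups:
  assumes "finite (carrier G)"
  shows "finite (proper_normal_subgroups G)"
proof (rule finite_subset)
  show "proper_normal_subgroups G \<subseteq> Pow (carrier G)"
    using normal_imp_subgroup subgroup.subset by (fastforce simp: proper_normal_subgroups_def)
qed (use assms in simp)

lemma maximal_normal_subgroup_above:
  assumes "finite (carrier G)" "N \<in> proper_normal_subgroups G"
  obtains M where "M \<in> maximal_normal_subgroups G" "N \<subseteq> M"
  using finite_has_maximal2[OF finite_proper_normal_subgroups[OF assms(1)] assms(2)]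
  by (auto simp: maximal_normal_subgroups_def)

lemma (in group) normal_Int:
  assumes "A \<lhd> G" "B \<lhd> G"
  shows "A \<inter> B \<lhd> G"
  using assms by (simp add: normal_inv_iff subgroups_Inter_pair)

text \<open>
  This is the form in which simplicity of the quotient by a maximal normal subgroup is used.
\<close>

lemma (in group) set_mult_maximal_normal_subgroup:
  assumes M: "M \<in> maximal_normal_subgroups G" and A: "A \<lhd> G" "\<not> A \<subseteq> M"
  shows "A <#> M = carrier G"
proof (rule ccontr)
  note sub = maximal_normal_subgroupD(2)[OF M] normal_imp_subgroup[OF A(1)]
  assume "A <#> M \<noteq> carrier G"
  then have "A <#> M \<in> proper_normal_subgroups G"
    using normal_subgroup_set_mult_closed[OF A(1) maximal_normal_subgroupD(1)[OF M]]
    by (simp add: proper_normal_subgroups_def)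
  moreover have "M \<subseteq> A <#> M"
  proof
    fix x assume "x \<in> M"
    then have "\<one> \<otimes> x \<in> A <#> M"
      using subgroup.one_closed[OF sub(2)] unfolding set_mult_def by blast
    then show "x \<in> A <#> M"
      using \<open>x \<in> M\<close> subgroup.mem_carrier[OF sub(1)] by simp
  qed
  moreover have "A \<subseteq> A <#> M"
  proof
    fix x assume "x \<in> A"
    then have "x \<otimes> \<one> \<in> A <#> M"
      using subgroup.one_closed[OF sub(1)] unfolding set_mult_def by blast
    then show "x \<in> A <#> M"
      using \<open>x \<in> A\<close> subgroup.mem_carrier[OF sub(2)] by simp
  qed
  ultimately show False
    using M A(2) by (auto simp: maximal_normal_subgroups_def)
qed

text \<open>
  A subfamily of least cardinality with the same intersection does it: whenever a member is dropped, the
  intersection grows, and any new point lies in all remaining members but not in the dropped one.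
  The ambient set \<open>X\<close> matters for families with a single member, where dropping it leaves the empty
  intersection.
\<close>

lemma irredundant_subfamily:
  assumes "finite \<M>" "\<M> \<noteq> {}" and proper: "\<forall>L\<in>\<M>. L \<subset> X"
  shows "\<exists>(p::nat) M. (\<forall>i\<le>p. M i \<in> \<M>) \<and> (\<forall>L\<in>\<M>. X \<inter> (\<Inter>i\<le>p. M i) \<subseteq> L) \<and>
    (\<forall>i\<le>p. \<exists>x\<in>X. x \<notin> M i \<and> (\<forall>j\<le>p. j \<noteq> i \<longrightarrow> x \<in> M j))"
proof -
  define P where "P S \<longleftrightarrow> S \<subseteq> \<M> \<and> (\<forall>x\<in>X. (\<forall>L\<in>S. x \<in> L) \<longrightarrow> (\<forall>L\<in>\<M>. x \<in> L))" for S
  have "P \<M>"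
    by (simp add: P_def)
  then obtain S where S: "P S" and least: "\<And>T. P T \<Longrightarrow> card S \<le> card T"
    using ex_has_least_nat[of P \<M> card] by blast
  have finS: "finite S"
    using S assms(1) by (auto simp: P_def intro: finite_subset)
  have "S \<noteq> {}"
    using S assms(2) proper by (fastforce simp: P_def)
  then obtain p where p: "card S = Suc p"
    using finS by (metis card_eq_0_iff not0_implies_Suc)
  obtain M where M: "bij_betw M {0..<card S} S"
    using ex_bij_betw_nat_finite[OF finS] by blast
  have range: "{0..<card S} = {..p}"
    using p by auto
  have M_img: "M ` {..p} = S" and M_inj: "inj_on M {..p}"
    using M by (auto simp: bij_betw_def range)
  show ?thesis
  proof (intro exI[of _ p] exI[of _ M] conjI allI ballI impI)
    show "M i \<in> \<M>" if "i \<le> p" for i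
      using that M_img S by (auto simp: P_def)
    show "X \<inter> (\<Inter>i\<le>p. M i) \<subseteq> L" if "L \<in> \<M>" for L
      using S that M_img unfolding P_def by blast
    show "\<exists>x\<in>X. x \<notin> M i \<and> (\<forall>j\<le>p. j \<noteq> i \<longrightarrow> x \<in> M j)" if "i \<le> p" for i
    proof -
      have "M i \<in> S"
        using M_img that by auto
      then have "card (S - {M i}) < card S"
        using finS by (meson card_Diff1_less)
      then have "\<not> P (S - {M i})"
        using least leD by blast
      then obtain x where x: "x \<in> X" "\<forall>L\<in>S - {M i}. x \<in> L" "\<not> (\<forall>L\<in>\<M>. x \<in> L)"
        using S by (auto simp: P_def)
      have "x \<notin> M i"
      proof
        assume "x \<in> M i"
        then have "\<forall>L\<in>S. x \<in> L"
          using x(2) by blast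
        then show False
          using S x(1,3) unfolding P_def by blast
      qed
      moreover have "x \<in> M j" if "j \<le> p" "j \<noteq> i" for j
      proof -
        have "M j \<in> S - {M i}"
          using M_img M_inj that \<open>i \<le> p\<close> by (auto simp: inj_on_eq_iff)
        then show ?thesis
          using x(2) by blast
      qed
      ultimately show ?thesis
        using x(1) by blast
    qed
  qed
qed

text \<open>
  A Chinese remainder statement: the product of the \<open>x i\<close> with \<open>i \<in> B\<close>, in any order, is congruent to
  \<open>x i\<close> modulo \<open>M i\<close> for \<open>i \<in> B\<close> and trivial modulo the other subgroups.
\<close>

lemma (in group) ex_in_cosets_of_independent_family:
  assumes normal: "\<And>i. i \<in> I \<Longrightarrow> M i \<lhd> G"
    and x: "\<And>i. i \<in> I \<Longrightarrow> x i \<in> carrier G" "\<And>i j. i \<in> I \<Longrightarrow> j \<in> I \<Longrightarrow> j \<noteq> i \<Longrightarrow> x i \<in> M j"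
    and "finite B" "B \<subseteq> I"
  shows "\<exists>z\<in>carrier G. (\<forall>i\<in>B. z \<in> x i <# M i) \<and> (\<forall>i\<in>I - B. z \<in> M i)"
  using assms(4,5)
proof (induction B rule: finite_induct)
  case empty
  have "\<one> \<in> M i" if "i \<in> I" for i
    using normal[OF that] normal_imp_subgroup subgroup.one_closed by blast
  then show ?case
    by auto
next
  case (insert b B)
  then obtain z where z: "z \<in> carrier G" "\<And>i. i \<in> B \<Longrightarrow> z \<in> x i <# M i"
      "\<And>i. i \<in> I - B \<Longrightarrow> z \<in> M i"
    by auto
  have b: "b \<in> I"
    using insert by blast
  have "z \<otimes> x b \<in> x b <# M b"
  proof -
    have "z \<otimes> x b \<in> M b #> x b"
      using z(3)[of b] b insert(2) by (auto simp: r_coset_def)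
    then show ?thesis
      using normal.coset_eq[OF normal[OF b]] x(1)[OF b] by simp
  qed
  moreover have "z \<otimes> x b \<in> x i <# M i" if "i \<in> B" for i
  proof -
    have i: "i \<in> I" "b \<noteq> i"
      using insert that by auto
    have sub: "subgroup (M i) G"
      using normal[OF i(1)] by (rule normal_imp_subgroup)
    obtain m where m: "m \<in> M i" "z = x i \<otimes> m"
      using z(2)[OF \<open>i \<in> B\<close>] by (auto simp: l_coset_def)
    have "m \<otimes> x b \<in> M i"
      using subgroup.m_closed[OF sub m(1)] x(2)[OF b i(1)] i(2) by metis
    moreover have "z \<otimes> x b = x i \<otimes> (m \<otimes> x b)"
      using m x(1) i(1) b subgroup.mem_carrier[OF sub m(1)] by (simp add: m_assoc)
    ultimately show ?thesis
      by (auto simp: l_coset_def)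
  qed
  moreover have "z \<otimes> x b \<in> M i" if "i \<in> I - insert b B" for i
    using that z(3)[of i] x(2)[OF b, of i] normal[of i]
    by (auto intro!: subgroup.m_closed normal_imp_subgroup)
  ultimately show ?case
    using z(1) x(1)[OF b] by (intro bexI[of _ "z \<otimes> x b"]) auto
qed

section \<open>Colouring a group along a chain of normal subgroups\<close>

text \<open>
  The colour of an element records its position in the descending chain of the partial intersections
  \<open>M 0 \<inter> \<dots> \<inter> M (i - 1)\<close>; the value \<open>p + 1\<close> marks the elements of the full intersection.
\<close>

definition colour :: "nat \<Rightarrow> (nat \<Rightarrow> 'a set) \<Rightarrow> 'a \<Rightarrow> nat"
  where "colour p M x = (LEAST i. i = Suc p \<or> x \<notin> M i)"

lemma colour_le: "colour p M x \<le> Suc p"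
  unfolding colour_def by (rule Least_le) simp

lemma mem_if_less_colour: "i < colour p M x \<Longrightarrow> x \<in> M i"
  unfolding colour_def using not_less_Least by blast

lemma colour_notin:
  assumes "colour p M x \<le> p"
  shows "x \<notin> M (colour p M x)"
  using LeastI[of "\<lambda>i. i = Suc p \<or> x \<notin> M i" "Suc p"] assms by (auto simp: colour_def)

lemma colour_eqI:
  assumes "i \<le> Suc p" "i \<le> p \<Longrightarrow> x \<notin> M i" "\<And>j. j < i \<Longrightarrow> x \<in> M j"
  shows "colour p M x = i"
  unfolding colour_def
proof (rule Least_equality)
  show "i = Suc p \<or> x \<notin> M i"
    using assms(1,2) by (cases "i = Suc p") auto
  show "i \<le> j" if "j = Suc p \<or> x \<notin> M j" for j
    using assms(1,3) that not_less by blast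
qed

text \<open>
  Suppose that the coset has elements of all colours.  Its element of colour \<open>p + 1\<close> lies in all the
  \<open>M i\<close>, hence in \<open>L\<close>, so the whole coset lies in \<open>L\<close>.  Let \<open>D i\<close> be the intersection of
  \<open>M 0, \<dots>, M (i - 1)\<close>.  An element of colour \<open>i \<le> p\<close> in the coset lies in \<open>D i \<inter> L\<close> but not in \<open>M i\<close>.
  So the quotient of \<open>D i\<close> by \<open>D (i + 1)\<close> is a chief factor in which \<open>D i \<inter> L\<close> has a nontrivial image,
  and \<open>D i\<close> is contained in \<open>L\<close> as soon as \<open>D (i + 1)\<close> is.  Descending from \<open>i = p + 1\<close> to \<open>i = 0\<close>,
  the whole group is contained in \<open>L\<close>.
\<close>

lemma (in group) proper_coset_misses_colour:
  assumes max: "\<And>i. i \<le> p \<Longrightarrow> M i \<in> maximal_normal_subgroups G"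
    and rad: "carrier G \<inter> (\<Inter>i\<le>p. M i) \<subseteq> L"
    and L: "L \<in> maximal_normal_subgroups G" and N: "subgroup N G" "N \<subseteq> L"
    and g: "g \<in> carrier G"
  shows "\<exists>k\<le>Suc p. k \<notin> colour p M ` (g <# N)"
proof (rule ccontr)
  assume "\<not> ?thesis"
  then have all: "\<exists>x\<in>g <# N. colour p M x = k" if "k \<le> Suc p" for k
    using that by blast
  have coset_carrier: "x \<in> carrier G" if "x \<in> g <# N" for x
    using that g N(1) l_coset_carrier by blast
  obtain y where y: "y \<in> g <# N" "colour p M y = Suc p"
    using all by blast
  then have "y \<in> L"
    using coset_carrier mem_if_less_colour[of _ p M y] by (intro subsetD[OF rad]) auto
  have in_L: "x \<in> L" if "x \<in> g <# N" for x
  proof -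
    have "x \<in> y <# N"
      using l_repr_independence[OF y(1) g N(1)] that by simp
    then show ?thesis
      using N(2) \<open>y \<in> L\<close> subgroup.m_closed[OF maximal_normal_subgroupD(2)[OF L]]
      by (auto simp: l_coset_def)
  qed
  define D where "D i = {x \<in> carrier G. \<forall>j<i. x \<in> M j}" for i
  have D_normal: "D i \<lhd> G" if "i \<le> Suc p" for i
    using that
  proof (induction i)
    case 0
    then show ?case
      by (simp add: D_def normal_inv_iff subgroup_self)
  next
    case (Suc i)
    have "D (Suc i) = D i \<inter> M i"
      by (auto simp: D_def less_Suc_eq)
    then show ?case
      using normal_Int[OF Suc.IH maximal_normal_subgroupD(1)[OF max]] Suc.prems by simp
  qed
  have "D i \<subseteq> L" if "i \<le> Suc p" for i
    using that
  proof (induction i rule: inc_induct)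
    case base
    then show ?case
      using rad by (auto simp: D_def)
  next
    case (step i)
    then have "i \<le> p" by simp
    obtain x where x: "x \<in> g <# N" "colour p M x = i"
      using all[of i] \<open>i \<le> p\<close> by auto
    have "x \<in> D i \<inter> L"
      using x coset_carrier in_L mem_if_less_colour[of _ p M x] by (auto simp: D_def)
    moreover have "x \<notin> M i"
      using colour_notin[of p M x] x(2) \<open>i \<le> p\<close> by simp
    ultimately have "\<not> D i \<inter> L \<subseteq> M i"
      by blast
    moreover have "D i \<inter> L \<lhd> G"
      using normal_Int[OF D_normal maximal_normal_subgroupD(1)[OF L]] \<open>i \<le> p\<close> by simp
    ultimately have mult: "(D i \<inter> L) <#> M i = carrier G"
      using set_mult_maximal_normal_subgroup max \<open>i \<le> p\<close> by blast
    show ?case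
    proof
      fix y assume y: "y \<in> D i"
      then have "y \<in> (D i \<inter> L) <#> M i"
        using mult by (simp add: D_def)
      then obtain d m where dm: "d \<in> D i" "d \<in> L" "m \<in> M i" "y = d \<otimes> m"
        by (auto simp: set_mult_def)
      have D_sub: "subgroup (D i) G"
        using D_normal \<open>i \<le> p\<close> by (simp add: normal_imp_subgroup)
      have m_carrier: "m \<in> carrier G"
        using dm(3) maximal_normal_subgroupD(3)[OF max[OF \<open>i \<le> p\<close>]] by blast
      have d_carrier: "d \<in> carrier G"
        using dm(1) by (simp add: D_def)
      have "m = inv d \<otimes> y"
        using dm(4) m_carrier d_carrier by (simp add: inv_solve_left)
      then have "m \<in> D i"
        using D_sub dm(1) y by (simp add: subgroup.m_closed subgroup.m_inv_closed)
      then have "m \<in> D (Suc i)"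
        using dm(3) by (auto simp: D_def less_Suc_eq)
      then have "m \<in> L"
        using step.IH by blast
      then show "y \<in> L"
        using dm subgroup.m_closed[OF maximal_normal_subgroupD(2)[OF L]] by blast
    qed
  qed
  from this[of 0] have "carrier G \<subseteq> L"
    by (simp add: D_def)
  then show False
    using maximal_normal_subgroupD(3)[OF L] by blast
qed


section \<open>The nerve of cosets of proper normal subgroups\<close>

text \<open>
  The vertices \<open>M i\<close> and \<open>x i M i\<close>, where \<open>x i\<close> is a separating element given by irredundance, are the
  antipodal pairs of the cross-polytope; the labels are missing colours.
\<close>

lemma (in group) normal_coset_nerve_not_contractible_if_irredundant:
  fixes p :: nat
  assumes finite_carrier: "finite (carrier G)"
    and max: "\<And>i. i \<le> p \<Longrightarrow> M i \<in> maximal_normal_subgroups G"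
    and rad: "\<And>L. L \<in> maximal_normal_subgroups G \<Longrightarrow> carrier G \<inter> (\<Inter>i\<le>p. M i) \<subseteq> L"
    and sep: "\<And>i. i \<le> p \<Longrightarrow> \<exists>x\<in>carrier G. x \<notin> M i \<and> (\<forall>j\<le>p. j \<noteq> i \<longrightarrow> x \<in> M j)"
  shows "\<not> contractible_space (normal_coset_nerve G)"
proof -
  define K where "K = coset_nerve_complex G (proper_normal_subgroups G)"
  obtain x where x_carrier: "\<And>i. i \<le> p \<Longrightarrow> x i \<in> carrier G"
    and x_notin: "\<And>i. i \<le> p \<Longrightarrow> x i \<notin> M i"
    and x_in: "\<And>i j. i \<le> p \<Longrightarrow> j \<le> p \<Longrightarrow> j \<noteq> i \<Longrightarrow> x i \<in> M j"
    using sep by metis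
  have M_sub: "subgroup (M i) G" if "i \<le> p" for i
    using maximal_normal_subgroupD(2)[OF max[OF that]] .

  define missing where "missing C = {k. k \<le> Suc p \<and> k \<notin> colour p M ` C}" for C
  \<comment> \<open>The greatest missing colour is used to fix the labels on the cross-polytope: \<open>M i\<close> misses only the
    colour \<open>i\<close>, while a coset of \<open>M i\<close> other than \<open>M i\<close> misses the colour \<open>p + 1\<close>, and possibly others.\<close>
  define label where "label C = Max (missing C)" for C
  have finite_missing: "finite (missing C)" for C
    by (simp add: missing_def)
  have label_missing: "label C \<in> missing C" if C: "C \<in> all_cosets G (proper_normal_subgroups G)" for C
  proof -
    obtain g N where gN: "C = g <#\<^bsub>G\<^esub> N" "g \<in> carrier G" "N \<in> proper_normal_subgroups G"
      using C by (auto simp: all_cosets_def)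
    then obtain L where L: "L \<in> maximal_normal_subgroups G" "N \<subseteq> L"
      using maximal_normal_subgroup_above[OF finite_carrier] by blast
    have "subgroup N G"
      using gN(3) by (simp add: proper_normal_subgroups_def normal_imp_subgroup)
    then have "missing C \<noteq> {}"
      using proper_coset_misses_colour[OF max rad[OF L(1)] L(1) _ L(2) gN(2)] gN(1)
      by (auto simp: missing_def)
    then show ?thesis
      unfolding label_def using finite_missing by (rule Max_in[rotated])
  qed

  have label_M: "label (M i) = i" if i: "i \<le> p" for i
    unfolding label_def
  proof (rule Max_eqI[OF finite_missing])
    show "i \<in> missing (M i)"
      using i colour_notin[of p M] by (force simp: missing_def)
    \<comment> \<open>Every colour \<open>k > i\<close> occurs in \<open>M i\<close>: that of \<open>x k\<close> is \<open>k\<close>, and that of the unit is \<open>p + 1\<close>.\<close>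
    show "k \<le> i" if "k \<in> missing (M i)" for k
    proof (rule ccontr)
      assume "\<not> k \<le> i"
      have k: "k \<le> Suc p" "k \<notin> colour p M ` M i"
        using that by (auto simp: missing_def)
      show False
      proof (cases "k = Suc p")
        case True
        have "colour p M \<one>\<^bsub>G\<^esub> = Suc p"
          using subgroup.one_closed[OF M_sub] by (intro colour_eqI) auto
        then show False
          using k True subgroup.one_closed[OF M_sub[OF i]] by force
      next
        case False
        then have "colour p M (x k) = k"
          using k(1) x_notin x_in by (intro colour_eqI) auto
        moreover have "x k \<in> M i"
          using x_in False k(1) i \<open>\<not> k \<le> i\<close> by simp
        ultimately show False
          using k(2) by force
      qed
    qed
  qed
  have label_xM: "label (x i <#\<^bsub>G\<^esub> M i) = Suc p" if i: "i \<le> p" for i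
    unfolding label_def
  proof (rule Max_eqI[OF finite_missing])
    have "colour p M y \<noteq> Suc p" if y: "y \<in> x i <#\<^bsub>G\<^esub> M i" for y
    proof
      assume "colour p M y = Suc p"
      then have "y \<in> M i"
        using i by (intro mem_if_less_colour[of i p]) simp
      moreover have "x i \<in> y <#\<^bsub>G\<^esub> M i"
        using l_coset_swap[OF y x_carrier[OF i] M_sub[OF i]] .
      ultimately have "x i \<in> M i"
        using subgroup.m_closed[OF M_sub[OF i]] by (auto simp: l_coset_def)
      then show False
        using x_notin[OF i] by simp
    qed
    then show "Suc p \<in> missing (x i <#\<^bsub>G\<^esub> M i)"
      by (force simp: missing_def)
  qed (simp add: missing_def)

  have "\<not> contractible_space (geometric_realization K)"
  proof (rule not_contractible_geometric_realization_if_labelled)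
    have "all_cosets G (proper_normal_subgroups G) \<subseteq> Pow (carrier G)"
      unfolding all_cosets_def proper_normal_subgroups_def
      using l_coset_subset_G[OF subgroup.subset[OF normal_imp_subgroup]] by blast
    then have "finite (all_cosets G (proper_normal_subgroups G))"
      using finite_carrier finite_subset by blast
    moreover have "K \<subseteq> Pow (all_cosets G (proper_normal_subgroups G))"
      by (auto simp: K_def coset_nerve_complex_def)
    ultimately show "finite K"
      using finite_subset by blast
    show "finite \<sigma>" if "\<sigma> \<in> K" for \<sigma>
      using that by (simp add: K_def coset_nerve_complex_def)
    show "label C \<le> Suc p" if "\<sigma> \<in> K" "C \<in> \<sigma>" for \<sigma> C
      using label_missing[of C] that by (auto simp: K_def coset_nerve_complex_def missing_def)
    show "\<exists>k\<le>Suc p. k \<notin> label ` \<sigma>" if "\<sigma> \<in> K" for \<sigma>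
    proof -
      obtain y where y: "y \<in> \<Inter>\<sigma>"
        using \<open>\<sigma> \<in> K\<close> by (auto simp: K_def coset_nerve_complex_def)
      have "label C \<noteq> colour p M y" if "C \<in> \<sigma>" for C
        using label_missing[of C] \<open>\<sigma> \<in> K\<close> that y
        by (auto simp: K_def coset_nerve_complex_def missing_def)
      then show ?thesis
        using colour_le by (intro exI[of _ "colour p M y"]) force
    qed
    show "label (M i) = i" if "i \<le> p" for i
      using that by (rule label_M)
    show "label (x i <#\<^bsub>G\<^esub> M i) = Suc p" if "i \<le> p" for i
      using that by (rule label_xM)
    show "M ` A \<union> (\<lambda>i. x i <#\<^bsub>G\<^esub> M i) ` B \<in> K"
      if AB: "A \<subseteq> {..p}" "B \<subseteq> {..p}" "A \<inter> B = {}" "A \<union> B \<noteq> {}" for A B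
    proof -
      have fin: "finite A" "finite B"
        using AB(1,2) finite_subset by blast+
      have proper: "M i \<in> proper_normal_subgroups G" if "i \<le> p" for i
        using max[OF that] by (simp add: maximal_normal_subgroups_def)
      have coset: "y <#\<^bsub>G\<^esub> M i \<in> all_cosets G (proper_normal_subgroups G)"
        if "y \<in> carrier G" "i \<le> p" for y i
        using that proper unfolding all_cosets_def by blast
      have M_coset: "M i \<in> all_cosets G (proper_normal_subgroups G)" if "i \<le> p" for i
        using coset[OF one_closed that] lcos_mult_one[OF subgroup.subset[OF M_sub[OF that]]] by simp
      have "\<exists>z\<in>carrier G. (\<forall>i\<in>B. z \<in> x i <#\<^bsub>G\<^esub> M i) \<and> (\<forall>i\<in>{..p} - B. z \<in> M i)"
        using maximal_normal_subgroupD(1)[OF max] x_carrier x_in fin(2) AB(2)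
        by (intro ex_in_cosets_of_independent_family) auto
      then obtain z where z: "\<And>i. i \<in> B \<Longrightarrow> z \<in> x i <#\<^bsub>G\<^esub> M i" "\<And>i. i \<in> {..p} - B \<Longrightarrow> z \<in> M i"
        by blast
      have "\<forall>C\<in>M ` A \<union> (\<lambda>i. x i <#\<^bsub>G\<^esub> M i) ` B. z \<in> C"
        using z AB(1,3) by blast
      then have "\<Inter>(M ` A \<union> (\<lambda>i. x i <#\<^bsub>G\<^esub> M i) ` B) \<noteq> {}"
        by (metis InterI empty_iff)
      moreover have "M i \<in> all_cosets G (proper_normal_subgroups G)" if "i \<in> A" for i
        using M_coset AB(1) that by blast
      moreover have "x i <#\<^bsub>G\<^esub> M i \<in> all_cosets G (proper_normal_subgroups G)" if "i \<in> B" for i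
        using coset[OF x_carrier] AB(2) that by blast
      ultimately show ?thesis
        unfolding K_def coset_nerve_complex_def using fin AB(4) by (simp add: image_subset_iff)
    qed
  qed
  then show ?thesis
    by (simp add: normal_coset_nerve_def coset_nerve_def K_def)
qed

theorem theorem20:
  fixes G :: "('a, 'b) monoid_scheme"
  assumes "group G" and "finite (carrier G)"
  shows "\<not> nonempty_contractible_space (normal_coset_nerve G)"
proof
  assume contr: "nonempty_contractible_space (normal_coset_nerve G)"
  interpret group G by fact
  \<comment> \<open>The trivial group is excluded here, because its nerve is empty.\<close>
  have "coset_nerve_complex G (proper_normal_subgroups G) \<noteq> {}"
    using contr
    by (auto simp: nonempty_contractible_space_def normal_coset_nerve_def coset_nerve_def
        topspace_geometric_realization)
  then have "proper_normal_subgroups G \<noteq> {}"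
    by (auto simp: coset_nerve_complex_def all_cosets_def)
  then have max_nonempty: "maximal_normal_subgroups G \<noteq> {}"
    using maximal_normal_subgroup_above[OF assms(2)] by (metis empty_iff ex_in_conv)
  have max_finite: "finite (maximal_normal_subgroups G)"
    using finite_proper_normal_subgroups[OF assms(2)]
    by (auto simp: maximal_normal_subgroups_def)
  have max_proper: "\<forall>L\<in>maximal_normal_subgroups G. L \<subset> carrier G"
    using maximal_normal_subgroupD(3) by blast
  from irredundant_subfamily[OF max_finite max_nonempty max_proper]
  have "\<not> contractible_space (normal_coset_nerve G)"
  proof (elim exE conjE)
    fix p :: nat and M
    assume "\<forall>i\<le>p. M i \<in> maximal_normal_subgroups G"
      "\<forall>L\<in>maximal_normal_subgroups G. carrier G \<inter> (\<Inter>i\<le>p. M i) \<subseteq> L"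
      "\<forall>i\<le>p. \<exists>x\<in>carrier G. x \<notin> M i \<and> (\<forall>j\<le>p. j \<noteq> i \<longrightarrow> x \<in> M j)"
    then show ?thesis
      by (intro normal_coset_nerve_not_contractible_if_irredundant[OF assms(2), of p M]) simp_all
  qed
  then show False
    using contr by (simp add: nonempty_contractible_space_def)
qed

end
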